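(* Let $s\in\mathbb{N}$, $m_1,m_2\in\mathbb{Z}$ and $k_1,k_2\in\mathbb{N}'$. The sequence $n\mapsto F_{sn+m_1}^{k_1}F_{sn+m_2}^{k_2}$ has $Z$ transform $$\mathcal{Z}\left(F_{sn+m_1}^{k_1}F_{sn+m_2}^{k_2}\right)=z\,\frac{\displaystyle\sum_{i=0}^{k_1+k_2}\sum_{j=0}^{i}(-1)^{\frac{(sj+2(s+1))(j+1)}{2}}\binom{k_1+k_2+1}{j}_{F_s}F_{m_1+s(i-j)}^{k_1}F_{m_2+s(i-j)}^{k_2}\,y^{\frac{sj(j-1)}{2}}z^{k_1+k_2-i}}{\displaystyle\sum_{i=0}^{k_1+k_2+1}(-1)^{\frac{(si+2(s+1))(i+1)}{2}}\binom{k_1+k_2+1}{i}_{F_s}y^{\frac{si(i-1)}{2}}z^{k_1+k_2+1-i}}.$$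
   Context: $\mathbb{N}=\{1,2,\dots\}$, $\mathbb{N}'=\mathbb{N}\cup\{0\}$. $x,y$ are indeterminates and we abbreviate $F_n=F_n(x,y)$. The bivariate Fibonacci polynomials are $F_0=0$, $F_1=1$, $F_{n+2}=xF_{n+1}+yF_n$, extended to negative indices by $F_{-n}=-(-y)^{-n}F_n$ ($n\in\mathbb{N}$). For $n,k\in\mathbb{N}'$ the bivariate $s$-Fibopolynomial is $\binom{n}{k}_{F_s}=\frac{F_{sn}F_{s(n-1)}\cdots F_{s(n-k+1)}}{F_sF_{2s}\cdots F_{ks}}$ (equal to $1$ for $k=0$ and $k=n$, and to $0$ if $k>n$). The $Z$ transform of a sequence $(a_n)_{n\ge0}$ is $\mathcal{Z}(a_n)=\sum_{n\ge0}a_nz^{-n}$, regarded as a formal power series in $z^{-1}$ with coefficients in $\mathbb{C}(x,y)$ (equivalently, for fixed complex $x,y$ with $y\neq0$, as a function of $z$ for $|z|$ large). Zeroth powers equal $1$. *)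

theory Defs
  imports "HOL-Computational_Algebra.Computational_Algebra"
begin

text \<open>
  The coefficient field \<open>\<complex>(x,y)\<close> is the fraction field of \<open>\<complex>[x][y]\<close>: the inner polynomial
  variable is \<open>x\<close>, the outer one is \<open>y\<close>.
\<close>

type_synonym ratfun_xy = "complex poly poly fract"

definition indet_x :: ratfun_xy where
  "indet_x = to_fract [:[:0, 1:]:]"

definition indet_y :: ratfun_xy where
  "indet_y = to_fract [:0, 1:]"

fun fib_nat :: "nat \<Rightarrow> ratfun_xy" where
  "fib_nat 0 = 0"
| "fib_nat (Suc 0) = 1"
| "fib_nat (Suc (Suc n)) = indet_x * fib_nat (Suc n) + indet_y * fib_nat n"

definition fib_poly :: "int \<Rightarrow> ratfun_xy" where
  "fib_poly m = (if m \<ge> 0 then fib_nat (nat m)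
                 else - ((- indet_y) powi m) * fib_nat (nat (- m)))"

text \<open>
  For \<open>k > n\<close> the numerator contains the factor \<open>F\<^sub>0 = 0\<close>, so the value is \<open>0\<close>.
\<close>

definition fibopoly :: "nat \<Rightarrow> nat \<Rightarrow> nat \<Rightarrow> ratfun_xy" where
  "fibopoly s n k =
     (\<Prod>i<k. fib_poly (int s * (int n - int i))) / (\<Prod>i=1..k. fib_poly (int s * int i))"

text \<open>
  A formal Laurent series in the variable \<^const>\<open>fls_X\<close> is read as a series in \<open>z\<^sup>-\<^sup>1\<close>, so that
  \<open>z\<close> is \<^const>\<open>fls_X_inv\<close>. Formal Laurent series over a field form a field, in which quotients of
  polynomials in \<open>z\<close> are taken.
\<close>

definition Z_transform :: "(nat \<Rightarrow> 'a::zero) \<Rightarrow> 'a fls" where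
  "Z_transform a = fps_to_fls (Abs_fps a)"

abbreviation z_var :: "'a::{zero,one} fls" where
  "z_var \<equiv> fls_X_inv"

text \<open>
  The exponents \<open>(s j + 2 (s + 1)) (j + 1) / 2\<close> and \<open>s j (j - 1) / 2\<close> below are natural numbers, so
  \<open>div\<close> is exact; for \<open>j = 0\<close> the truncated \<open>j - 1\<close> is multiplied by \<open>0\<close>.
\<close>

definition sign_coeff :: "nat \<Rightarrow> nat \<Rightarrow> ratfun_xy" where
  "sign_coeff s j = (- 1) ^ (((s * j + 2 * (s + 1)) * (j + 1)) div 2)"

definition y_coeff :: "nat \<Rightarrow> nat \<Rightarrow> ratfun_xy" where
  "y_coeff s j = indet_y ^ ((s * j * (j - 1)) div 2)"

end

theory Submission
  imports Defs "HOL-Algebra.Algebraic_Closure_Type"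
begin

text \<open>
  In an algebraic closure, \<open>F\<^sub>m = (\<alpha>\<^sup>m - \<beta>\<^sup>m) / (\<alpha> - \<beta>)\<close> with \<open>\<alpha> + \<beta> = x\<close> and \<open>\<alpha>\<beta> = - y\<close>. With
  \<open>a = \<alpha>\<^sup>s\<close>, \<open>b = \<beta>\<^sup>s\<close>, \<open>N = k\<^sub>1 + k\<^sub>2 + 1\<close>, expanding the powers shows that the sequence is a linear
  combination of the geometric sequences with ratios \<open>a\<^sup>r b\<^sup>N\<^sup>-\<^sup>1\<^sup>-\<^sup>r\<close>, \<open>r < N\<close>. The Fibopolynomials are
  the homogeneous Gaussian binomials in \<open>a, b\<close>, so by the \<open>q\<close>-binomial theorem the denominator is, up to
  sign and a power of \<open>z\<close>, the product of the \<open>1 - a\<^sup>r b\<^sup>N\<^sup>-\<^sup>1\<^sup>-\<^sup>r z\<^sup>-\<^sup>1\<close>. Hence its coefficients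
  annihilate the sequence, and the numerator is what remains of the Cauchy product.
\<close>

subsection \<open>Homogeneous Gaussian binomials\<close>

text \<open>The Gaussian binomial made homogeneous in \<open>a\<close> and \<open>b\<close>. The
  Pascal rule avoids division, so any commutative ring will do; the truncated \<open>n - k\<close>
  is harmless, as \<open>hbinom a b n k\<close> is 0 for \<open>k > n\<close>.\<close>

fun hbinom :: "'a::comm_ring_1 \<Rightarrow> 'a \<Rightarrow> nat \<Rightarrow> nat \<Rightarrow> 'a" where
  "hbinom a b n 0 = 1"
| "hbinom a b 0 (Suc k) = 0"
| "hbinom a b (Suc n) (Suc k) = b ^ Suc k * hbinom a b n (Suc k) + a ^ (n - k) * hbinom a b n k"

lemma hbinom_eq_0: "n < k \<Longrightarrow> hbinom a b n k = 0"
  by (induction a b n k rule: hbinom.induct) auto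

text \<open>Induction along the Pascal rule, driven by \<open>a^(n+1) - b^(n+1) = b^(k+1) (a^(n-k) -
  b^(n-k)) + a^(n-k) (a^(k+1) - b^(k+1))\<close> for \<open>k \<le> n\<close>.\<close>

lemma hbinom_prod:
  "hbinom a b n k * (\<Prod>i=1..k. a ^ i - b ^ i) = (\<Prod>i<k. a ^ (n - i) - b ^ (n - i))"
proof (induction a b n k rule: hbinom.induct)
  case (1 a b n)
  then show ?case by simp
next
  case (2 a b k)
  then show ?case by (simp add: prod.lessThan_Suc_shift)
next
  case (3 a b n k)
  let ?g = "\<lambda>i. a ^ i - b ^ i"
  let ?P = "\<Prod>i<k. ?g (n - i)"
  have "hbinom a b (Suc n) (Suc k) * (\<Prod>i=1..Suc k. ?g i) =
      b ^ Suc k * (hbinom a b n (Suc k) * (\<Prod>i=1..Suc k. ?g i))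
      + a ^ (n - k) * ?g (Suc k) * (hbinom a b n k * (\<Prod>i=1..k. ?g i))"
    by (simp add: algebra_simps)
  also have "\<dots> = ?P * (b ^ Suc k * ?g (n - k) + a ^ (n - k) * ?g (Suc k))"
    unfolding 3 by (simp add: algebra_simps)
  also have "\<dots> = ?P * ?g (Suc n)"
  proof (cases "k \<le> n")
    case True
    then have "a ^ Suc n = a ^ (n - k) * a ^ Suc k" "b ^ Suc n = b ^ Suc k * b ^ (n - k)"
      unfolding power_add[symmetric] by simp_all
    then show ?thesis by (simp only: algebra_simps)
  next
    case False
    \<comment> \<open>The factor at \<open>i = n\<close> is \<open>a^0 - b^0\<close>.\<close>
    then have "?P = 0" by (intro prod_zero bexI[of _ n]) auto
    then show ?thesis by simp
  qed
  also have "\<dots> = (\<Prod>i<Suc k. ?g (Suc n - i))"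
    by (subst prod.lessThan_Suc_shift) (simp add: mult.commute)
  finally show ?case .
qed

definition gauss_coeff :: "'a::comm_ring_1 \<Rightarrow> 'a \<Rightarrow> nat \<Rightarrow> nat \<Rightarrow> 'a" where
  "gauss_coeff a b n j = (- 1) ^ j * (a * b) ^ (j choose 2) * hbinom a b n j"

text \<open>Induction on \<open>n\<close>: besides the new factor \<open>r = n\<close>, every factor
  gains one \<open>b\<close>, which is absorbed by replacing \<open>w\<close> with
  \<open>b * w\<close>. Hence \<open>w\<close> is arbitrary.\<close>

lemma q_binomial:
  "(\<Sum>j\<le>n. gauss_coeff a b n j * w ^ j) = (\<Prod>r<n. 1 - a ^ r * b ^ (n - 1 - r) * w)"
proof (induction n arbitrary: w)
  case 0
  then show ?case by (simp add: gauss_coeff_def numeral_2_eq_2)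
next
  case (Suc n)
  let ?c = "gauss_coeff a b n"
  have step: "gauss_coeff a b (Suc n) (Suc k) * w ^ Suc k =
      ?c (Suc k) * (b * w) ^ Suc k - a ^ n * w * (?c k * (b * w) ^ k)" if "k \<le> n" for k
  proof -
    have "Suc k choose 2 = (k choose 2) + k" by (simp add: numeral_2_eq_2)
    then have 1: "(a * b) ^ (Suc k choose 2) = (a * b) ^ (k choose 2) * (a ^ k * b ^ k)"
      by (simp only: power_add power_mult_distrib)
    have 2: "a ^ n = a ^ k * a ^ (n - k)" using that by (simp flip: power_add)
    show ?thesis
      unfolding gauss_coeff_def hbinom.simps 1 2
      by (simp add: algebra_simps power_mult_distrib)
  qed
  have "(\<Sum>j\<le>Suc n. gauss_coeff a b (Suc n) j * w ^ j) =
      1 + (\<Sum>k\<le>n. gauss_coeff a b (Suc n) (Suc k) * w ^ Suc k)"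
    by (subst sum.atMost_Suc_shift) (simp add: gauss_coeff_def numeral_2_eq_2)
  also have "\<dots> = (1 + (\<Sum>k\<le>n. ?c (Suc k) * (b * w) ^ Suc k))
      - a ^ n * w * (\<Sum>k\<le>n. ?c k * (b * w) ^ k)"
    by (simp add: step sum_subtractf sum_distrib_left del: power_Suc)
  also have "1 + (\<Sum>k\<le>n. ?c (Suc k) * (b * w) ^ Suc k) = (\<Sum>k\<le>Suc n. ?c k * (b * w) ^ k)"
    by (subst sum.atMost_Suc_shift) (simp add: gauss_coeff_def numeral_2_eq_2)
  also have "\<dots> = (\<Sum>k\<le>n. ?c k * (b * w) ^ k)"
    by (simp add: gauss_coeff_def hbinom_eq_0)
  also have "\<dots> - a ^ n * w * \<dots> = \<dots> * (1 - a ^ n * w)"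
    by (simp add: algebra_simps)
  also have "\<dots> = (\<Prod>r<n. 1 - a ^ r * b ^ (n - 1 - r) * (b * w)) * (1 - a ^ n * w)"
    by (simp only: Suc)
  also have "(\<Prod>r<n. 1 - a ^ r * b ^ (n - 1 - r) * (b * w)) = (\<Prod>r<n. 1 - a ^ r * b ^ (n - r) * w)"
  proof (intro prod.cong refl)
    fix r assume "r \<in> {..<n}"
    then have "b ^ (n - r) = b ^ (n - 1 - r) * b" by (simp flip: power_Suc2 add: Suc_diff_Suc)
    then show "1 - a ^ r * b ^ (n - 1 - r) * (b * w) = 1 - a ^ r * b ^ (n - r) * w"
      by (simp add: mult_ac)
  qed
  finally show ?case by simp
qed

text \<open>The sum is \<open>t^i\<close> times the product in \<open>q_binomial\<close> at
  \<open>w = 1 / t\<close>, where factor \<open>r\<close> vanishes.\<close>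

lemma gauss_coeff_annihilates_power:
  fixes a b :: "'a::field"
  assumes "a \<noteq> 0" "b \<noteq> 0" "r < n" "n \<le> i"
  defines "t \<equiv> a ^ r * b ^ (n - 1 - r)"
  shows "(\<Sum>j\<le>n. gauss_coeff a b n j * t ^ (i - j)) = 0"
proof -
  have t: "t \<noteq> 0" using assms by simp
  have "(\<Sum>j\<le>n. gauss_coeff a b n j * t ^ (i - j)) =
      t ^ i * (\<Sum>j\<le>n. gauss_coeff a b n j * (1 / t) ^ j)"
    unfolding sum_distrib_left using t \<open>n \<le> i\<close>
    by (intro sum.cong refl) (simp add: power_diff field_simps)
  also have "(\<Sum>j\<le>n. gauss_coeff a b n j * (1 / t) ^ j) = 0"
    unfolding q_binomial using t \<open>r < n\<close> by (intro prod_zero bexI[of _ r]) (auto simp: t_def)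
  finally show ?thesis by simp
qed

text \<open>By the binomial theorem the summand is a combination of powers of the ratios
  \<open>a^(p+q) * b^(n-1-(p+q))\<close> with \<open>p + q < n\<close>, each annihilated by the
  preceding lemma.\<close>

lemma gauss_coeff_annihilates:
  fixes a b :: "'a::field"
  assumes "a \<noteq> 0" "b \<noteq> 0" and n: "n = k1 + k2 + 1" "n \<le> i"
  shows "(\<Sum>j\<le>n. gauss_coeff a b n j *
      ((A1 * a ^ (i - j) + B1 * b ^ (i - j)) ^ k1 * (A2 * a ^ (i - j) + B2 * b ^ (i - j)) ^ k2)) = 0"
proof -
  let ?K = "\<lambda>k A B p. of_nat (k choose p) * A ^ p * B ^ (k - p)"
  have expand: "(A * a ^ l + B * b ^ l) ^ k = (\<Sum>p\<le>k. ?K k A B p * (a ^ p * b ^ (k - p)) ^ l)"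
    for A B k l
    by (simp add: binomial_ring power_mult_distrib mult_ac flip: power_mult)
  have "(\<Sum>j\<le>n. gauss_coeff a b n j *
      ((A1 * a ^ (i - j) + B1 * b ^ (i - j)) ^ k1 * (A2 * a ^ (i - j) + B2 * b ^ (i - j)) ^ k2)) =
      (\<Sum>j\<le>n. \<Sum>p\<le>k1. \<Sum>q\<le>k2. ?K k1 A1 B1 p * ?K k2 A2 B2 q *
         (gauss_coeff a b n j * (a ^ (p + q) * b ^ (n - 1 - (p + q))) ^ (i - j)))"
    unfolding expand sum_product unfolding sum_distrib_left
  proof (intro sum.cong refl)
    fix j p q assume "p \<in> {..k1}" "q \<in> {..k2}"
    then have "n - 1 - (p + q) = (k1 - p) + (k2 - q)" using n by simp
    then show "gauss_coeff a b n j *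
        (?K k1 A1 B1 p * (a ^ p * b ^ (k1 - p)) ^ (i - j) *
         (?K k2 A2 B2 q * (a ^ q * b ^ (k2 - q)) ^ (i - j))) =
        ?K k1 A1 B1 p * ?K k2 A2 B2 q *
         (gauss_coeff a b n j * (a ^ (p + q) * b ^ (n - 1 - (p + q))) ^ (i - j))"
      by (simp only: power_add power_mult_distrib mult_ac)
  qed
  also have "\<dots> = (\<Sum>p\<le>k1. \<Sum>q\<le>k2. \<Sum>j\<le>n. ?K k1 A1 B1 p * ?K k2 A2 B2 q *
         (gauss_coeff a b n j * (a ^ (p + q) * b ^ (n - 1 - (p + q))) ^ (i - j)))"
    by (subst sum.swap, subst (2) sum.swap) (rule refl)
  also have "\<dots> = 0"
    unfolding sum_distrib_left[symmetric]
  proof (rule sum.neutral, rule ballI, rule sum.neutral, rule ballI)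
    fix p q assume "p \<in> {..k1}" "q \<in> {..k2}"
    then have "p + q < n" using n by simp
    then have "(\<Sum>j\<le>n. gauss_coeff a b n j * (a ^ (p + q) * b ^ (n - 1 - (p + q))) ^ (i - j)) = 0"
      using assms by (intro gauss_coeff_annihilates_power)
    then show "?K k1 A1 B1 p * ?K k2 A2 B2 q *
        (\<Sum>j\<le>n. gauss_coeff a b n j * (a ^ (p + q) * b ^ (n - 1 - (p + q))) ^ (i - j)) = 0"
      by simp
  qed
  finally show ?thesis .
qed

subsection \<open>Binet's formula\<close>

text \<open>Setting \<open>y = 0\<close> turns F_(n+1) into x^n. The induction also carries that F_n
  is a polynomial, so that its term \<open>y * F_n\<close> vanishes there.\<close>

lemma fib_nat_nonzero: "fib_nat (Suc n) \<noteq> 0"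
proof -
  have "\<exists>p q. fib_nat (Suc n) = to_fract p \<and> poly p 0 = [:0, 1:] ^ n \<and> fib_nat n = to_fract q"
  proof (induction n)
    case 0
    then show ?case by (intro exI[of _ 1] exI[of _ 0]) simp
  next
    case (Suc n)
    then obtain p q where "fib_nat (Suc n) = to_fract p" "poly p 0 = [:0, 1:] ^ n"
      "fib_nat n = to_fract q" by blast
    then show ?case
      by (intro exI[of _ "[:[:0, 1:]:] * p + [:0, 1:] * q"] exI[of _ p])
        (simp add: indet_x_def indet_y_def del: to_fract_add to_fract_mult
          flip: to_fract_add to_fract_mult)
  qed
  then show ?thesis
    by (metis poly_0 power_not_zero pCons_eq_0_iff one_neq_zero to_fract_eq_0_iff)
qed

lemma indet_y_nonzero: "indet_y \<noteq> 0"
  by (simp add: indet_y_def)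

lemma discriminant_nonzero: "indet_x ^ 2 + 4 * indet_y \<noteq> 0"
proof -
  \<comment> \<open>The discriminant of t^2 - x t - y, as the image of an explicit
    polynomial.\<close>
  have "indet_x ^ 2 + 4 * indet_y =
      to_fract ([:[:0, 1:]:] * [:[:0, 1:]:] + ([:0, 1:] + [:0, 1:] + [:0, 1:] + [:0, 1:]))"
    unfolding indet_x_def indet_y_def to_fract_add to_fract_mult by (simp add: power2_eq_square)
  then show ?thesis by (simp del: to_fract_add to_fract_mult)
qed

text \<open>The roots of t^2 - x t - y are taken in the algebraic closure; \<open>to_ac\<close>
  embeds the coefficient field there.\<close>

lemma binet:
  obtains \<alpha> \<beta> :: "ratfun_xy alg_closure"
  where "\<alpha> * \<beta> = - to_ac indet_y" "\<alpha> \<noteq> 0" "\<beta> \<noteq> 0" "\<alpha> \<noteq> \<beta>"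
    "\<And>m. to_ac (fib_poly m) = (\<alpha> powi m - \<beta> powi m) / (\<alpha> - \<beta>)"
proof -
  let ?x = "to_ac indet_x" and ?y = "to_ac indet_y"
  obtain \<alpha> where \<alpha>: "poly [:- ?y, - ?x, 1:] \<alpha> = 0"
    using alg_closed_imp_poly_has_root[of "[:- ?y, - ?x, 1:]"] by auto
  \<comment> \<open>The other root, by Vieta.\<close>
  define \<beta> where "\<beta> = ?x - \<alpha>"
  have sum: "?x = \<alpha> + \<beta>" by (simp add: \<beta>_def)
  have prd: "\<alpha> * \<beta> = - ?y" using \<alpha> by (simp add: \<beta>_def algebra_simps add_eq_0_iff)
  have y: "?y = - (\<alpha> * \<beta>)" by (simp add: prd)
  have nz: "\<alpha> \<noteq> 0" "\<beta> \<noteq> 0" using prd indet_y_nonzero by auto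
  have "(\<alpha> - \<beta>) ^ 2 = to_ac (indet_x ^ 2 + 4 * indet_y)"
    by (simp add: sum y power2_eq_square algebra_simps)
  then have ne: "\<alpha> \<noteq> \<beta>" using discriminant_nonzero
    by (metis diff_self power_zero_numeral to_ac_eq_0_iff)
  have nat: "(\<alpha> - \<beta>) * to_ac (fib_nat n) = \<alpha> ^ n - \<beta> ^ n" for n
  proof (induction n rule: fib_nat.induct)
    case (3 n)
    have "(\<alpha> - \<beta>) * to_ac (fib_nat (Suc (Suc n))) =
        ?x * ((\<alpha> - \<beta>) * to_ac (fib_nat (Suc n))) + ?y * ((\<alpha> - \<beta>) * to_ac (fib_nat n))"
      by (simp add: algebra_simps)
    also have "\<dots> = \<alpha> ^ Suc (Suc n) - \<beta> ^ Suc (Suc n)"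
      unfolding 3 sum y by (simp add: algebra_simps)
    finally show ?case .
  qed auto
  have powi: "to_ac (c powi m) = to_ac c powi m" for c :: ratfun_xy and m
    by (simp add: power_int_def)
  have "(\<alpha> - \<beta>) * to_ac (fib_poly m) = \<alpha> powi m - \<beta> powi m" for m
  proof (cases "m \<ge> 0")
    case True
    then show ?thesis by (simp add: fib_poly_def nat power_int_def)
  next
    case False
    define n where "n = nat (- m)"
    have m: "m = - int n" using False by (simp add: n_def)
    \<comment> \<open>The factor (-y)^m in the definition at negative indices is
      (\<alpha>\<beta>)^m, which turns \<alpha>^n - \<beta>^n into \<beta>^m - \<alpha>^m.\<close>
    have "(\<alpha> - \<beta>) * to_ac (fib_poly m) = - ((\<alpha> * \<beta>) powi m) * ((\<alpha> - \<beta>) * to_ac (fib_nat n))"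
      using False by (simp add: fib_poly_def powi prd n_def)
    also have "\<dots> = \<alpha> powi m - \<beta> powi m"
      unfolding nat m using nz by (simp add: power_int_minus field_simps)
    finally show ?thesis .
  qed
  then have "to_ac (fib_poly m) = (\<alpha> powi m - \<beta> powi m) / (\<alpha> - \<beta>)" for m
    using ne by (simp add: field_simps)
  then show thesis using that prd nz ne by blast
qed

section \<open>Signs and powers of y in terms of binomial coefficients\<close>

lemma double_choose_two: "2 * (n choose 2) = n * (n - 1)"
  unfolding choose_two by (intro dvd_mult_div_cancel) (cases n; simp)

text \<open>Separates a sign independent of \<open>j\<close>, the sign in
  \<open>gauss_coeff\<close>, and the sign that (-y)^s contributes when raised to
  \<open>j choose 2\<close>.\<close>

lemma sign_coeff_eq: "sign_coeff s j = (- 1) ^ (s + 1) * (- 1) ^ j * (- 1) ^ (s * (j choose 2))"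
proof -
  have c: "2 * (j choose 2) = j * (j - 1)" by (rule double_choose_two)
  have "(s * j + 2 * (s + 1)) * (j + 1) = 2 * (s * (j choose 2) + s * j + (s + 1) * (j + 1))"
  proof (cases j)
    case (Suc k)
    have "s * (2 * (j choose 2)) = s * (j * (j - 1))" by (simp only: c)
    then show ?thesis by (simp add: algebra_simps Suc del: binomial_Suc_Suc binomial_Suc_n)
  qed simp
  then have "((s * j + 2 * (s + 1)) * (j + 1)) div 2 =
      2 * (s * j) + ((s + 1) + j + s * (j choose 2))"
    by (simp add: algebra_simps)
  then show ?thesis
    by (simp only: sign_coeff_def power_add power_mult) simp
qed

lemma y_coeff_eq: "y_coeff s j = indet_y ^ (s * (j choose 2))"
proof -
  have "s * j * (j - 1) = 2 * (s * (j choose 2))" 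
    using double_choose_two[of j] by (metis mult.assoc mult.left_commute)
  then show ?thesis by (simp only: y_coeff_def) simp
qed

subsection \<open>Generating functions of linear recurrences\<close>

text \<open>The recurrence truncates the Cauchy product of \<open>d\<close> and \<open>a\<close>
  after index \<open>n\<close>. Clearing negative powers takes z^n above and z^(n+1) below, whence
  the leading factor z.\<close>

lemma Z_transform_rational:
  fixes a d :: "nat \<Rightarrow> 'a::field"
  assumes d0: "d 0 \<noteq> 0"
    and rec: "\<And>i. i \<ge> Suc n \<Longrightarrow> (\<Sum>j\<le>Suc n. d j * a (i - j)) = 0"
  shows "Z_transform a = z_var *
    ((\<Sum>i=0..n. \<Sum>j=0..i. fls_const (d j * a (i - j)) * z_var ^ (n - i))
     / (\<Sum>i=0..Suc n. fls_const (d i) * z_var ^ (Suc n - i)))"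
proof -
  define D where "D = Abs_fps (\<lambda>i. if i \<le> Suc n then d i else 0)"
  define C where "C = Abs_fps (\<lambda>i. if i \<le> n then \<Sum>j=0..i. d j * a (i - j) else 0)"
  \<comment> \<open>Coefficient \<open>i\<close> belongs to z^(-i), so a polynomial in z with
    reversed coefficients is z^m times a truncated series.\<close>
  have poly_z: "(\<Sum>i=0..m. fls_const (c i) * z_var ^ (m - i)) =
      z_var ^ m * fps_to_fls (Abs_fps (\<lambda>i. if i \<le> m then c i else 0))" for c :: "nat \<Rightarrow> 'a" and m
  proof -
    have "fps_to_fls (Abs_fps (\<lambda>i. if i \<le> m then c i else 0)) =
        fps_to_fls (\<Sum>i=0..m. fps_const (c i) * fps_X ^ i)"
      by (intro arg_cong[where f = fps_to_fls] fps_ext)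
        (simp add: fps_sum_nth fps_X_power_nth if_distrib[of "(*) _"] cong: if_cong)
    also have "\<dots> = (\<Sum>i=0..m. fls_const (c i) * fls_X ^ i)"
    proof -
      have "fps_to_fls (sum f A) = (\<Sum>i\<in>A. fps_to_fls (f i))" for f :: "nat \<Rightarrow> 'a fps" and A
        by (induction A rule: infinite_finite_induct) simp_all
      then show ?thesis by (simp add: fls_times_fps_to_fls fps_to_fls_power)
    qed
    also have "z_var ^ m * \<dots> = (\<Sum>i=0..m. fls_const (c i) * z_var ^ (m - i))"
      unfolding sum_distrib_left
    proof (intro sum.cong refl)
      fix i assume i: "i \<in> {0..m}"
      have "(z_var :: 'a fls) ^ m = z_var ^ (m - i) * z_var ^ i" using i by (simp flip: power_add)
      moreover have "(z_var :: 'a fls) ^ i * fls_X ^ i = 1"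
        by (metis fls_X_nonzero fls_inverse_X left_inverse power_mult_distrib power_one)
      ultimately show "z_var ^ m * (fls_const (c i) * fls_X ^ i) = fls_const (c i) * z_var ^ (m - i)"
        by (metis (no_types, opaque_lifting) mult.assoc mult.commute mult.right_neutral)
    qed
    finally show ?thesis by simp
  qed
  have num: "(\<Sum>i=0..n. \<Sum>j=0..i. fls_const (d j * a (i - j)) * z_var ^ (n - i)) =
      z_var ^ n * fps_to_fls C"
  proof -
    have "fls_const (sum f A) = (\<Sum>i\<in>A. fls_const (f i))" for f :: "nat \<Rightarrow> 'a" and A
      by (induction A rule: infinite_finite_induct) (simp_all flip: fls_plus_const)
    then show ?thesis
      unfolding C_def poly_z[symmetric] by (simp add: sum_distrib_right)
  qed
  have "D * Abs_fps a = C"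
  proof (rule fps_ext)
    fix i
    have *: "(D * Abs_fps a) $ i = (\<Sum>j=0..i. (if j \<le> Suc n then d j else 0) * a (i - j))"
      by (simp add: fps_mult_nth D_def)
    show "(D * Abs_fps a) $ i = C $ i"
    proof (cases "i \<le> n")
      case True
      then show ?thesis unfolding * by (auto simp: C_def intro!: sum.cong)
    next
      case False
      then have "(\<Sum>j=0..i. (if j \<le> Suc n then d j else 0) * a (i - j)) =
          (\<Sum>j\<le>Suc n. d j * a (i - j))"
        by (intro sum.mono_neutral_cong_right) auto
      also have "\<dots> = 0" using False by (intro rec) simp
      finally show ?thesis unfolding * using False by (simp add: C_def)
    qed
  qed
  moreover have "D \<noteq> 0"
  proof
    assume "D = 0"
    then have "D $ 0 = 0" by simp
    then show False using d0 by (simp add: D_def)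
  qed
  ultimately show ?thesis
    unfolding num poly_z D_def[symmetric] Z_transform_def
    by (simp add: field_simps flip: fls_times_fps_to_fls)
qed

section \<open>Transform of the product of Fibonacci powers\<close>

theorem theorem6:
  fixes s k1 k2 :: nat and m1 m2 :: int
  assumes "s \<ge> 1"
  shows "Z_transform (\<lambda>n. fib_poly (int s * int n + m1) ^ k1 * fib_poly (int s * int n + m2) ^ k2) =
    z_var *
    ((\<Sum>i=0..k1 + k2. \<Sum>j=0..i.
        fls_const (sign_coeff s j * fibopoly s (k1 + k2 + 1) j
                   * fib_poly (m1 + int s * (int i - int j)) ^ k1
                   * fib_poly (m2 + int s * (int i - int j)) ^ k2
                   * y_coeff s j)
        * z_var ^ (k1 + k2 - i))
     / (\<Sum>i=0..k1 + k2 + 1.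
        fls_const (sign_coeff s i * fibopoly s (k1 + k2 + 1) i * y_coeff s i)
        * z_var ^ (k1 + k2 + 1 - i)))"
proof -
  define N where "N = k1 + k2 + 1"
  define u where
    "u = (\<lambda>n. fib_poly (int s * int n + m1) ^ k1 * fib_poly (int s * int n + m2) ^ k2)"
  define d where "d = (\<lambda>j. sign_coeff s j * fibopoly s N j * y_coeff s j)"
  obtain \<alpha> \<beta> :: "ratfun_xy alg_closure" where
    prd: "\<alpha> * \<beta> = - to_ac indet_y" and nz: "\<alpha> \<noteq> 0" "\<beta> \<noteq> 0" and ne: "\<alpha> \<noteq> \<beta>"
    and fib: "\<And>m. to_ac (fib_poly m) = (\<alpha> powi m - \<beta> powi m) / (\<alpha> - \<beta>)"
    by (rule binet) blast
  define a b where "a = \<alpha> ^ s" and "b = \<beta> ^ s"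
  have fib_s: "to_ac (fib_poly (int s * int n)) = (a ^ n - b ^ n) / (\<alpha> - \<beta>)" for n
    by (simp add: fib a_def b_def power_int_def nat_mult_distrib power_mult)
  have g: "a ^ n - b ^ n \<noteq> 0" if "n \<ge> 1" for n
  proof -
    \<comment> \<open>Here \<open>s \<ge> 1\<close> makes the index positive, so that
      \<open>fib_nat_nonzero\<close> applies.\<close>
    have "fib_poly (int s * int n) = fib_nat (Suc (s * n - 1))"
      using that assms by (simp add: fib_poly_def nat_mult_distrib)
    then have "to_ac (fib_poly (int s * int n)) \<noteq> 0" using fib_nat_nonzero by simp
    then show ?thesis unfolding fib_s by auto
  qed
  \<comment> \<open>Numerator and denominator both have \<open>j\<close> factors, so the powers of
    \<alpha> - \<beta> cancel.\<close>
  have fibo: "to_ac (fibopoly s N j) = hbinom a b N j" if "j \<le> N" for j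
  proof -
    have "(\<Prod>i<j. to_ac (fib_poly (int s * (int N - int i)))) =
        (\<Prod>i<j. (a ^ (N - i) - b ^ (N - i)) / (\<alpha> - \<beta>))"
      using that by (intro prod.cong refl) (simp add: fib_s flip: of_nat_diff)
    then have "to_ac (fibopoly s N j) =
        (\<Prod>i<j. (a ^ (N - i) - b ^ (N - i)) / (\<alpha> - \<beta>)) / (\<Prod>i=1..j. (a ^ i - b ^ i) / (\<alpha> - \<beta>))"
      by (simp add: fibopoly_def to_ac_prod fib_s)
    also have "\<dots> = (\<Prod>i<j. a ^ (N - i) - b ^ (N - i)) / (\<Prod>i=1..j. a ^ i - b ^ i)"
      using ne by (simp add: prod_dividef)
    also have "\<dots> = hbinom a b N j"
      unfolding hbinom_prod[symmetric] using g by simp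
    finally show ?thesis .
  qed
  have d: "to_ac (d j) = (- 1) ^ (s + 1) * gauss_coeff a b N j" if "j \<le> N" for j
  proof -
    \<comment> \<open>This matches (ab)^(j choose 2) with the sign and the power of y.\<close>
    have "a * b = (- 1) ^ s * to_ac indet_y ^ s"
      by (simp add: a_def b_def prd flip: power_mult_distrib)
    then show ?thesis
      by (simp add: d_def sign_coeff_eq y_coeff_eq gauss_coeff_def fibo[OF that]
          power_mult power_mult_distrib mult_ac)
  qed
  \<comment> \<open>The shift \<open>m\<close> enters only through the coefficients of a^n and
    b^n.\<close>
  define A where "A = (\<lambda>m. \<alpha> powi m / (\<alpha> - \<beta>))"
  define B where "B = (\<lambda>m. - (\<beta> powi m) / (\<alpha> - \<beta>))"
  have fib_shift: "to_ac (fib_poly (int s * int n + m)) = A m * a ^ n + B m * b ^ n" for n m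
  proof -
    have "c powi (int s * int n + m) = c powi m * (c ^ s) ^ n" if "c \<noteq> 0"
      for c :: "ratfun_xy alg_closure"
    proof -
      have "c powi (int s * int n) = (c ^ s) ^ n"
        by (metis of_nat_mult power_int_of_nat power_mult)
      then show ?thesis using that by (simp add: power_int_add)
    qed
    then show ?thesis
      using nz by (simp add: fib A_def B_def a_def b_def diff_divide_distrib)
  qed
  have "(\<Sum>j\<le>N. d j * u (i - j)) = 0" if "N \<le> i" for i
  proof -
    \<comment> \<open>The recurrence is checked in the closure and pulled back by injectivity of
      \<open>to_ac\<close>.\<close>
    have "to_ac (\<Sum>j\<le>N. d j * u (i - j)) = (- 1) ^ (s + 1) * (\<Sum>j\<le>N. gauss_coeff a b N j *
        ((A m1 * a ^ (i - j) + B m1 * b ^ (i - j)) ^ k1 *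
         (A m2 * a ^ (i - j) + B m2 * b ^ (i - j)) ^ k2))"
      unfolding to_ac_sum sum_distrib_left
      by (intro sum.cong refl) (simp add: d u_def fib_shift mult_ac)
    also have "\<dots> = 0"
      using nz that by (subst gauss_coeff_annihilates) (auto simp: a_def b_def N_def)
    finally show ?thesis by simp
  qed
  moreover have "d 0 \<noteq> 0"
    by (simp add: d_def sign_coeff_eq y_coeff_def fibopoly_def)
  ultimately have "Z_transform u = z_var *
    ((\<Sum>i=0..k1 + k2. \<Sum>j=0..i. fls_const (d j * u (i - j)) * z_var ^ (k1 + k2 - i))
     / (\<Sum>i=0..k1 + k2 + 1. fls_const (d i) * z_var ^ (k1 + k2 + 1 - i)))"
    using Z_transform_rational[of d "k1 + k2" u] by (simp add: N_def)
  also have "(\<Sum>i=0..k1 + k2. \<Sum>j=0..i. fls_const (d j * u (i - j)) * z_var ^ (k1 + k2 - i)) =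
      (\<Sum>i=0..k1 + k2. \<Sum>j=0..i.
        fls_const (sign_coeff s j * fibopoly s (k1 + k2 + 1) j
                   * fib_poly (m1 + int s * (int i - int j)) ^ k1
                   * fib_poly (m2 + int s * (int i - int j)) ^ k2
                   * y_coeff s j)
        * z_var ^ (k1 + k2 - i))"
    by (intro sum.cong refl) (simp add: d_def u_def N_def of_nat_diff add.commute mult_ac)
  finally show ?thesis unfolding d_def u_def N_def .
qed

end
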